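(* Let $k\ge 1$ be an integer and let $f,g$ be polynomials in one variable with integer coefficients, such that $f(x)$ is affinely independent to $x^k$, i.e. there is no $(u,v)\in\mathbb{Z}^2$ with $f(x)=ux^k+v$ or $x^k=uf(x)+v$ (as polynomials). Let $F(x,y)=f(x)+x^kg(y)$ and let $\alpha>1/2$. For any pair $(A,B)$ of subsets of $\mathbb{F}_p$ such that $|A|\asymp|B|\asymp p^{\alpha}$, we have $$|F(A,B)|\gg |A|^{1+\frac{\min\{2\alpha-1;\,2-2\alpha\}}{2}}.$$
   Context: Here $p$ is a prime and $\mathbb{F}_p$ is the field with $p$ elements; $F$ is viewed as a map $\mathbb{F}_p^2\to\mathbb{F}_p$ by reduction modulo $p$, and $F(A,B)=\{F(a,b):a\in A,\ b\in B\}\subseteq\mathbb{F}_p$. The condition $|A|\asymp|B|\asymp p^\alpha$ means $L_1p^\alpha\le|A|,|B|\le L_2p^\alpha$ for fixed positive constants $L_1\le L_2$; the implied constant in $\gg$ is positive and independent of $p,A,B$ (it may depend on $F,\alpha,L_1,L_2$).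
   Formalization: The polynomial g is assumed non-constant; for constant g the claim fails when 1/2 < α < 1 (e.g. g = 0, k = 1, f = x²), because then |F(A,B)| ≤ |A| while the claimed exponent exceeds 1. *)

theory Defs
  imports
    Complex_Main
    "HOL-Computational_Algebra.Polynomial"
    "HOL-Number_Theory.Residues"
begin

definition affinely_independent :: "int poly \<Rightarrow> int poly \<Rightarrow> bool" where
  "affinely_independent f h \<longleftrightarrow>
     \<not> (\<exists>u v :: int. f = Polynomial.smult u h + [:v:] \<or> h = Polynomial.smult u f + [:v:])"

definition bivariate :: "nat \<Rightarrow> int poly \<Rightarrow> int poly \<Rightarrow> int \<Rightarrow> int \<Rightarrow> int" where
  "bivariate k f g x y = poly f x + x ^ k * poly g y"

(* The prime field with p elements is represented by residue_ring (int p), whose carrier is the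
   set {0..int p - 1} of integer representatives. An integer polynomial map therefore induces a map
   on this field by evaluating at the representatives and reducing modulo p. *)
definition image_mod :: "nat \<Rightarrow> (int \<Rightarrow> int \<Rightarrow> int) \<Rightarrow> int set \<Rightarrow> int set \<Rightarrow> int set" where
  "image_mod p F A B = {F a b mod int p | a b. a \<in> A \<and> b \<in> B}"

end

theory Submission imports Defs "HOL-Analysis.Convex" begin

text \<open>
  Let \<open>C = F(A, B)\<close>. The proof shows \<open>|C| \<ge> c min (p, |A| |B| / p^(1/2))\<close>, a bound of order
  \<open>min (p, p^(2 \<alpha> - 1/2))\<close> which is at least as strong as the theorem (lemma
  \<open>expansion_exponent_le\<close>).

  The idea is to test \<open>A \<times> B\<close> against the balanced function \<open>h = 1_C - |C| / p\<close>, which has mean zero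
  on the prime field. If \<open>|C| \<le> p / 2\<close>, then \<open>h (F a b) \<ge> 1 / 2\<close> for all \<open>a \<in> A\<close>, \<open>b \<in> B\<close>, so
  the sum \<open>S\<close> of \<open>h (F a b)\<close> over \<open>A \<times> B\<close> is at least \<open>|A| |B| / 2\<close>. For an upper bound,
  Cauchy-Schwarz over \<open>b\<close>, with \<open>g b\<close> replaced by a variable \<open>y\<close> running through the whole field
  (each value of \<open>g\<close> is taken at most \<open>deg g\<close> times), and then Cauchy-Schwarz over pairs in
  \<open>A \<times> A\<close> give
  \<open>S^4 \<le> (deg g)^2 |A|^2 |B|^2 \<Sum>a. \<Sum>a'. T(a, a')^2\<close> with
  \<open>T(a, a') = \<Sum>y. h (f(a) + a^k y) h (f(a') + a'^k y)\<close>.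

  For \<open>a \<noteq> 0\<close> write \<open>a' = a w\<close>. Eliminating \<open>y\<close> turns \<open>T(a, a')\<close> into the correlation
  \<open>L(t, s) = \<Sum>u. h(u) h(t u + s)\<close> of \<open>h\<close> along the affine line of slope \<open>t = w^k\<close> and intercept
  \<open>s = f(a w) - w^k f(a)\<close> (\<open>pair_correlation_eq_line_corr\<close>). Two distinct points determine one
  line, so with mean zero only the diagonal survives in the second moment over all lines:
  \<open>\<Sum>t. \<Sum>s. L(t, s)^2 = p (\<Sum>u. h(u)^2)^2 \<le> p |C|^2\<close> (\<open>line_corr_second_moment\<close>).

  It remains to see that a line arises from boundedly many pairs. The slope has at most \<open>k\<close> preimages
  \<open>w\<close>. For fixed \<open>w\<close> the intercept is a polynomial in \<open>a\<close> whose coefficient at \<open>a^j\<close> is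
  \<open>f_j (w^j - w^k)\<close>; affine independence provides \<open>j \<ge> 1\<close>, \<open>j \<noteq> k\<close> with \<open>f_j \<noteq> 0\<close>, so the
  polynomial is nonconstant unless \<open>w\<close> is one of the boundedly many roots of \<open>w^j = w^k\<close>. These
  exceptional \<open>w\<close> are harmless, since each contributes at most \<open>|A| |C|^2 \<le> p |C|^2\<close>
  (\<open>pair_correlation_second_moment_le\<close>). Hence \<open>|A|^4 |B|^4 \<le> const |A|^2 |B|^2 p |C|^2\<close>, which is
  the bound stated first.
\<close>

section \<open>Polynomials and sums modulo a prime\<close>

(* The polynomial rings of the algebra hierarchy use the same short names as int poly. *)
hide_const (open) up_ring.coeff up_ring.monom Module.smult

text \<open>
  Lagrange's bound for a polynomial that does not vanish identically modulo \<open>p\<close>: dividing by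
  \<open>X - r\<close> for a root \<open>r\<close> lowers the degree and cannot produce a quotient that vanishes modulo \<open>p\<close>.
\<close>

lemma card_roots_mod_prime_le:
  fixes f :: "int poly" and p :: int
  assumes "prime p" and "\<not> p dvd coeff f i"
  shows "card {x \<in> {0..<p}. p dvd poly f x} \<le> degree f"
  using assms(2)
proof (induction "degree f" arbitrary: f i rule: less_induct)
  case less
  show ?case
  proof (cases "\<exists>r \<in> {0..<p}. p dvd poly f r")
    case False
    then have "{x \<in> {0..<p}. p dvd poly f x} = {}" by blast
    then show ?thesis by (metis card.empty le0)
  next
    case True
    then obtain r where r: "r \<in> {0..<p}" "p dvd poly f r" by blast
    define q where "q = synthetic_div f r"
    have f_eq: "f = [:-r, 1:] * q + [:poly f r:]"
      unfolding q_def by (rule synthetic_div_correct'[symmetric])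
    have "degree f \<noteq> 0"
    proof
      assume "degree f = 0"
      then obtain c where "f = [:c:]" by (rule degree_eq_zeroE)
      with r less.prems show False by (cases i) auto
    qed
    then have deg_q: "degree q < degree f" "degree f = Suc (degree q)"
      unfolding q_def by (simp_all add: degree_synthetic_div)
    have "\<exists>l. \<not> p dvd coeff q l"
    proof (rule ccontr)
      assume "\<not> ?thesis"
      then have "p dvd coeff ([:-r, 1:] * q + [:poly f r:]) i"
        using r by (auto simp: coeff_pCons split: nat.split)
      then show False using less.prems f_eq by metis
    qed
    then obtain l where "\<not> p dvd coeff q l" by blast
    with less.hyps deg_q have IH: "card {x \<in> {0..<p}. p dvd poly q x} \<le> degree q" by blast
    have "{x \<in> {0..<p}. p dvd poly f x} \<subseteq> insert r {x \<in> {0..<p}. p dvd poly q x}"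
    proof
      fix x assume x: "x \<in> {x \<in> {0..<p}. p dvd poly f x}"
      have "poly f x = (x - r) * poly q x + poly f r"
        by (subst f_eq) (simp add: algebra_simps)
      then have "p dvd (x - r) * poly q x"
        using x r by (metis (mono_tags, lifting) dvd_add_left_iff mem_Collect_eq)
      then consider "p dvd x - r" | "p dvd poly q x"
        using assms(1) prime_dvd_mult_iff by blast
      then show "x \<in> insert r {x \<in> {0..<p}. p dvd poly q x}"
      proof cases
        case 1
        then have "x mod p = r mod p" by (simp add: mod_eq_dvd_iff)
        then have "x = r" using x r by simp
        then show ?thesis by simp
      qed (use x in auto)
    qed
    then have "card {x \<in> {0..<p}. p dvd poly f x} \<le> card (insert r {x \<in> {0..<p}. p dvd poly q x})"
      by (intro card_mono finite.insertI finite_subset[OF _ finite_atLeastLessThan_int[of 0 p]]) auto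
    also have "\<dots> \<le> Suc (card {x \<in> {0..<p}. p dvd poly q x})"
      by (rule card_insert_le_m1) auto
    finally show ?thesis using IH deg_q by linarith
  qed
qed

text \<open>
  Functions on the prime field are modelled as \<open>p\<close>-periodic functions on the integers, so that no
  reduction modulo \<open>p\<close> has to be carried through their arguments.
\<close>

definition periodic_mod :: "int \<Rightarrow> (int \<Rightarrow> real) \<Rightarrow> bool" where
  "periodic_mod p h \<longleftrightarrow> (\<forall>x. h (x mod p) = h x)"

lemma periodic_modD: "periodic_mod p h \<Longrightarrow> h (x mod p) = h x"
  by (simp add: periodic_mod_def)

lemma periodic_mod_cong: "periodic_mod p h \<Longrightarrow> x mod p = y mod p \<Longrightarrow> h x = h y"
  by (metis periodic_modD)

lemma sum_affine_mod:
  fixes p :: int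
  assumes "prime p" and "\<not> p dvd t" and per: "periodic_mod p h"
  shows "(\<Sum>u\<in>{0..<p}. h (t * u + s)) = (\<Sum>u\<in>{0..<p}. h u)"
proof -
  have p: "p > 0" using assms(1) prime_gt_0_int by blast
  let ?m = "\<lambda>u. (t * u + s) mod p"
  have inj: "inj_on ?m {0..<p}"
  proof (rule inj_onI)
    fix u v assume uv: "u \<in> {0..<p}" "v \<in> {0..<p}" "?m u = ?m v"
    then have "p dvd t * (u - v)" by (simp add: mod_eq_dvd_iff algebra_simps)
    then have "p dvd u - v" using assms prime_dvd_mult_iff by blast
    then have "u mod p = v mod p" by (simp add: mod_eq_dvd_iff)
    then show "u = v" using uv by simp
  qed
  have "?m ` {0..<p} \<subseteq> {0..<p}" using p by auto
  then have img: "?m ` {0..<p} = {0..<p}" using inj by (simp add: endo_inj_surj)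
  have "(\<Sum>u\<in>{0..<p}. h (t * u + s)) = (\<Sum>u\<in>{0..<p}. h (?m u))"
    by (simp add: periodic_modD[OF per])
  also have "\<dots> = (\<Sum>u\<in>?m ` {0..<p}. h u)" using inj by (simp add: sum.reindex)
  finally show ?thesis using img by simp
qed

text \<open>
  A nonconstant polynomial takes each value modulo \<open>p\<close> at most \<open>degree P\<close> times. This serves for
  the values of \<open>g\<close>, for the slopes \<open>w ^ k\<close> and for the intercepts of the lines. The condition
  \<open>i \<ge> 1\<close> ensures that subtracting a constant leaves the \<open>i\<close>-th coefficient alone.
\<close>

lemma sum_poly_mod_le:
  fixes p :: int and P :: "int poly"
  assumes "prime p" and "i \<ge> 1" and "\<not> p dvd coeff P i"
    and per: "periodic_mod p h" and nonneg: "\<And>x. h x \<ge> 0"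
  shows "(\<Sum>a\<in>{0..<p}. h (poly P a)) \<le> real (degree P) * (\<Sum>s\<in>{0..<p}. h s)"
proof -
  have p: "p > 0" using assms(1) prime_gt_0_int by blast
  have fibre: "card {a \<in> {0..<p}. poly P a mod p = s} \<le> degree P" for s
  proof -
    have "coeff (P - [:s:]) i = coeff P i"
      using assms(2) by (cases i) auto
    then have "card {a \<in> {0..<p}. p dvd poly (P - [:s:]) a} \<le> degree (P - [:s:])"
      using assms by (intro card_roots_mod_prime_le[where i = i]) auto
    also have "\<dots> \<le> degree P" by (intro degree_diff_le) auto
    finally have le: "card {a \<in> {0..<p}. p dvd poly (P - [:s:]) a} \<le> degree P" .
    have "card {a \<in> {0..<p}. poly P a mod p = s} \<le> card {a \<in> {0..<p}. p dvd poly (P - [:s:]) a}"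
      by (intro card_mono finite_subset[OF _ finite_atLeastLessThan_int[of 0 p]])
         (auto simp: mod_eq_dvd_iff[symmetric])
    with le show ?thesis by linarith
  qed
  have "(\<Sum>a\<in>{0..<p}. h (poly P a)) = (\<Sum>a\<in>{0..<p}. h (poly P a mod p))"
    by (simp add: periodic_modD[OF per])
  also have "\<dots> = (\<Sum>s\<in>{0..<p}. \<Sum>a\<in>{a \<in> {0..<p}. poly P a mod p = s}. h (poly P a mod p))"
    using p by (intro sum.group[symmetric]) auto
  also have "\<dots> = (\<Sum>s\<in>{0..<p}. real (card {a \<in> {0..<p}. poly P a mod p = s}) * h s)"
    by (intro sum.cong refl) simp
  also have "\<dots> \<le> (\<Sum>s\<in>{0..<p}. real (degree P) * h s)"
    using fibre nonneg by (intro sum_mono mult_right_mono) auto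
  finally show ?thesis by (simp add: sum_distrib_left)
qed

section \<open>Correlations along affine lines\<close>

text \<open>
  The sum of \<open>h \<otimes> h\<close> over the points of the line \<open>z = t u + s\<close> in the plane over the prime field.
\<close>

definition line_corr :: "int \<Rightarrow> (int \<Rightarrow> real) \<Rightarrow> int \<Rightarrow> int \<Rightarrow> real" where
  "line_corr p h t s = (\<Sum>u\<in>{0..<p}. h u * h (t * u + s))"

lemma periodic_line_corr:
  assumes "periodic_mod p h"
  shows "line_corr p h (t mod p) (s mod p) = line_corr p h t s"
  unfolding line_corr_def
proof (intro sum.cong refl arg_cong2[where f = "(*)"] periodic_mod_cong[OF assms])
  fix u show "(t mod p * u + s mod p) mod p = (t * u + s) mod p"
    by (intro mod_add_cong mod_mult_cong) simp_all
qed

text \<open>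
  Expanding the square gives pairs of points with abscissae \<open>u\<close> and \<open>v\<close>. For \<open>u \<noteq> v\<close> the
  ordinates \<open>(t u + s, t v + s)\<close> run through all of the plane as \<open>(t, s)\<close> does, so the sum
  factors through the mean of \<open>h\<close> and vanishes; the diagonal \<open>u = v\<close> gives the right-hand side.
\<close>

lemma line_corr_second_moment:
  fixes p :: int
  assumes "prime p" and per: "periodic_mod p h" and mean0: "(\<Sum>u\<in>{0..<p}. h u) = 0"
  shows "(\<Sum>t\<in>{0..<p}. \<Sum>s\<in>{0..<p}. (line_corr p h t s)\<^sup>2)
         = real_of_int p * (\<Sum>u\<in>{0..<p}. (h u)\<^sup>2)\<^sup>2"
proof -
  let ?R = "{0..<p}" and ?Q = "\<Sum>u\<in>{0..<p}. (h u)\<^sup>2"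
  have p: "p > 0" using assms(1) prime_gt_0_int by blast
  have inner: "(\<Sum>t\<in>?R. \<Sum>s\<in>?R. h (t * u + s) * h (t * v + s))
      = (if u = v then real_of_int p * ?Q else 0)" if uv: "u \<in> ?R" "v \<in> ?R" for u v
  proof -
    \<comment> \<open>The shift \<open>s \<mapsto> s - t u\<close> isolates \<open>t\<close> in one factor, where it is multiplied by \<open>v - u\<close>.\<close>
    have "(\<Sum>s\<in>?R. h (t * u + s) * h (t * v + s)) = (\<Sum>s\<in>?R. h s * h ((v - u) * t + s))" for t
    proof -
      have per': "periodic_mod p (\<lambda>s. h s * h ((v - u) * t + s))"
        unfolding periodic_mod_def
        by (intro allI arg_cong2[where f = "(*)"] periodic_mod_cong[OF per]) (simp_all add: mod_add_right_eq)
      have "\<not> p dvd 1" using assms(1) not_prime_unit by blast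
      from sum_affine_mod[OF assms(1) this per', where s = "t * u"]
      show ?thesis by (simp add: algebra_simps)
    qed
    then have "(\<Sum>t\<in>?R. \<Sum>s\<in>?R. h (t * u + s) * h (t * v + s))
        = (\<Sum>t\<in>?R. \<Sum>s\<in>?R. h s * h ((v - u) * t + s))" by simp
    also have "\<dots> = (\<Sum>s\<in>?R. h s * (\<Sum>t\<in>?R. h ((v - u) * t + s)))"
      by (subst sum.swap) (simp add: sum_distrib_left)
    also have "\<dots> = (if u = v then real_of_int p * ?Q else 0)"
    proof (cases "u = v")
      case True
      then show ?thesis using p by (simp add: sum_distrib_left power2_eq_square mult_ac)
    next
      case False
      have "\<not> p dvd v - u"
      proof
        assume "p dvd v - u"
        then have "v mod p = u mod p" by (simp add: mod_eq_dvd_iff)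
        then show False using False uv by simp
      qed
      then show ?thesis using False sum_affine_mod[OF assms(1) _ per] mean0 by simp
    qed
    finally show ?thesis .
  qed
  have "(\<Sum>t\<in>?R. \<Sum>s\<in>?R. (line_corr p h t s)\<^sup>2)
      = (\<Sum>t\<in>?R. \<Sum>s\<in>?R. \<Sum>u\<in>?R. \<Sum>v\<in>?R. h u * h v * (h (t * u + s) * h (t * v + s)))"
    unfolding line_corr_def power2_eq_square sum_product by (simp add: mult_ac)
  also have "\<dots> = (\<Sum>t\<in>?R. \<Sum>u\<in>?R. \<Sum>s\<in>?R. \<Sum>v\<in>?R. h u * h v * (h (t * u + s) * h (t * v + s)))"
    by (intro sum.cong refl sum.swap)
  also have "\<dots> = (\<Sum>u\<in>?R. \<Sum>t\<in>?R. \<Sum>s\<in>?R. \<Sum>v\<in>?R. h u * h v * (h (t * u + s) * h (t * v + s)))"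
    by (rule sum.swap)
  also have "\<dots> = (\<Sum>u\<in>?R. \<Sum>t\<in>?R. \<Sum>v\<in>?R. \<Sum>s\<in>?R. h u * h v * (h (t * u + s) * h (t * v + s)))"
    by (intro sum.cong refl sum.swap)
  also have "\<dots> = (\<Sum>u\<in>?R. \<Sum>v\<in>?R. \<Sum>t\<in>?R. \<Sum>s\<in>?R. h u * h v * (h (t * u + s) * h (t * v + s)))"
    by (intro sum.cong refl sum.swap)
  also have "\<dots> = (\<Sum>u\<in>?R. \<Sum>v\<in>?R. h u * h v * (\<Sum>t\<in>?R. \<Sum>s\<in>?R. h (t * u + s) * h (t * v + s)))"
    by (simp add: sum_distrib_left)
  also have "\<dots> = (\<Sum>u\<in>?R. \<Sum>v\<in>?R. if u = v then h u * h v * (real_of_int p * ?Q) else 0)"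
    by (intro sum.cong refl) (simp add: inner)
  also have "\<dots> = (\<Sum>u\<in>?R. (h u)\<^sup>2 * (real_of_int p * ?Q))"
    by (intro sum.cong refl) (simp add: power2_eq_square)
  also have "\<dots> = real_of_int p * ?Q\<^sup>2"
    by (subst sum_distrib_right[symmetric]) (simp add: power2_eq_square mult_ac)
  finally show ?thesis .
qed

text \<open>
  The trivial bound for a single line. It comes from Cauchy-Schwarz when \<open>t\<close> is invertible, while a
  horizontal line has correlation zero because \<open>h\<close> has mean zero.
\<close>

lemma line_corr_sq_le:
  fixes p :: int
  assumes "prime p" and per: "periodic_mod p h" and mean0: "(\<Sum>u\<in>{0..<p}. h u) = 0"
  shows "(line_corr p h t s)\<^sup>2 \<le> (\<Sum>u\<in>{0..<p}. (h u)\<^sup>2)\<^sup>2"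
proof (cases "p dvd t")
  case True
  have "line_corr p h t s = (\<Sum>u\<in>{0..<p}. h u * h s)"
    unfolding line_corr_def
  proof (intro sum.cong refl arg_cong2[where f = "(*)"] periodic_mod_cong[OF per])
    fix u show "(t * u + s) mod p = s mod p" using True by (simp add: mod_eq_dvd_iff)
  qed
  also have "\<dots> = 0" by (simp flip: sum_distrib_right add: mean0)
  finally show ?thesis by simp
next
  case False
  have per2: "periodic_mod p (\<lambda>x. (h x)\<^sup>2)" using per by (simp add: periodic_mod_def)
  have "(line_corr p h t s)\<^sup>2 \<le> (\<Sum>u\<in>{0..<p}. (h u)\<^sup>2) * (\<Sum>u\<in>{0..<p}. (h (t * u + s))\<^sup>2)"
    unfolding line_corr_def by (rule Cauchy_Schwarz_ineq_sum)
  also have "\<dots> = (\<Sum>u\<in>{0..<p}. (h u)\<^sup>2)\<^sup>2"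
    using sum_affine_mod[OF assms(1) False per2] by (simp add: power2_eq_square)
  finally show ?thesis .
qed

lemma poly_mod_cong: "x mod p = y mod p \<Longrightarrow> poly (f :: int poly) x mod p = poly f y mod p"
proof (induction f)
  case (pCons a f)
  have "(a + x * poly f x) mod p = (a + y * poly f y) mod p"
    by (intro mod_add_cong mod_mult_cong refl pCons)
  then show ?case by simp
qed simp

section \<open>Correlations of the rows of the expander\<close>

text \<open>
  The substitution \<open>u = f(a) + a^k y\<close>, invertible since \<open>a \<noteq> 0\<close>. Writing the second point as
  \<open>a w\<close> avoids division by \<open>a\<close> modulo \<open>p\<close>.
\<close>

lemma pair_correlation_eq_line_corr:
  fixes p a w :: int
  assumes "prime p" and per: "periodic_mod p h" and "\<not> p dvd a"
  shows "(\<Sum>y\<in>{0..<p}. h (poly f a + a ^ k * y) * h (poly f (a * w) + (a * w) ^ k * y))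
         = line_corr p h (w ^ k) (poly f (a * w) - w ^ k * poly f a)"
proof -
  let ?c = "\<lambda>u. h u * h (w ^ k * u + (poly f (a * w) - w ^ k * poly f a))"
  have per': "periodic_mod p ?c"
    unfolding periodic_mod_def
  proof (intro allI arg_cong2[where f = "(*)"] periodic_mod_cong[OF per])
    fix x
    show "(w ^ k * (x mod p) + (poly f (a * w) - w ^ k * poly f a)) mod p
        = (w ^ k * x + (poly f (a * w) - w ^ k * poly f a)) mod p"
      by (intro mod_add_cong mod_mult_cong refl) simp
  qed simp
  have "\<not> p dvd a ^ k" using assms prime_dvd_power by blast
  from sum_affine_mod[OF assms(1) this per', where s = "poly f a"]
  show ?thesis unfolding line_corr_def by (simp add: algebra_simps power_mult_distrib)
qed

text \<open>
  The map \<open>(a, w) \<mapsto> (w^k, f(a w) - w^k f(a))\<close> from pairs to lines has fibres of size at most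
  \<open>k deg f\<close> outside the set \<open>bad\<close> of those \<open>w\<close> with \<open>w^j = w^k\<close>; the constant
  \<open>k deg f + (deg f + k)\<close> adds the fibre bound and the bound on the size of \<open>bad\<close>.
\<close>

lemma pair_correlation_second_moment_le:
  fixes p :: int and f :: "int poly"
  assumes "prime p" and per: "periodic_mod p h" and mean0: "(\<Sum>u\<in>{0..<p}. h u) = 0"
    and A: "A \<subseteq> {0..<p}" "0 \<notin> A" and k: "k \<ge> 1"
    and j: "j \<ge> 1" "j \<noteq> k" "\<not> p dvd coeff f j"
  shows "(\<Sum>a\<in>A. \<Sum>b\<in>A. (\<Sum>y\<in>{0..<p}. h (poly f a + a ^ k * y) * h (poly f b + b ^ k * y))\<^sup>2)
      \<le> real (degree f * k + (degree f + k)) * real_of_int p * (\<Sum>u\<in>{0..<p}. (h u)\<^sup>2)\<^sup>2"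
proof -
  let ?R = "{0..<p}"
  define Q where "Q = (\<Sum>u\<in>{0..<p}. (h u)\<^sup>2)\<^sup>2"
  define T where "T a b = (\<Sum>y\<in>{0..<p}. h (poly f a + a ^ k * y) * h (poly f b + b ^ k * y))" for a b
  define P where "P w = pcompose f [:0, w:] - smult (w ^ k) f" for w
  define bad where "bad = {w \<in> ?R. p dvd w ^ j - w ^ k}"
  have p: "p > 0" using assms(1) prime_gt_0_int by blast
  have Q0: "Q \<ge> 0" unfolding Q_def by simp
  have coeffP: "coeff (P w) i = coeff f i * (w ^ i - w ^ k)" for w i
    unfolding P_def by (simp add: coeff_pcompose_linear algebra_simps)
  have degP: "degree (P w) \<le> degree f" for w
    by (rule degree_le) (simp add: coeffP coeff_eq_0)
  have Tsum: "(\<Sum>b\<in>A. (T a b)\<^sup>2) \<le> (\<Sum>w\<in>?R. (line_corr p h (w ^ k) (poly (P w) a))\<^sup>2)"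
    if a: "a \<in> A" for a
  proof -
    have a_ndvd: "\<not> p dvd a" using A a by (metis atLeastLessThan_iff order_le_less subsetD zdvd_not_zless)
    have perT: "periodic_mod p (\<lambda>b. (T a b)\<^sup>2)"
      unfolding periodic_mod_def T_def
      by (intro allI arg_cong[where f = "\<lambda>x. x\<^sup>2"] sum.cong refl arg_cong2[where f = "(*)"]
          periodic_mod_cong[OF per] mod_add_cong mod_mult_cong poly_mod_cong)
         (simp_all add: power_mod)
    have "(\<Sum>b\<in>A. (T a b)\<^sup>2) \<le> (\<Sum>b\<in>?R. (T a b)\<^sup>2)"
      using A by (intro sum_mono2) auto
    also have "\<dots> = (\<Sum>w\<in>?R. (T a (a * w))\<^sup>2)"
      using sum_affine_mod[OF assms(1) a_ndvd perT, where s = 0] by simp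
    also have "\<dots> = (\<Sum>w\<in>?R. (line_corr p h (w ^ k) (poly (P w) a))\<^sup>2)"
      unfolding T_def pair_correlation_eq_line_corr[OF assms(1) per a_ndvd] P_def
      by (simp add: poly_pcompose mult.commute)
    finally show ?thesis .
  qed
  have per_s: "periodic_mod p (\<lambda>s. (line_corr p h t s)\<^sup>2)" for t
    unfolding periodic_mod_def by (metis per periodic_line_corr mod_mod_trivial)
  have per_t: "periodic_mod p (\<lambda>t. \<Sum>s\<in>?R. (line_corr p h t s)\<^sup>2)"
    unfolding periodic_mod_def
    by (intro allI sum.cong refl) (metis per periodic_line_corr mod_mod_trivial)
  have per_w: "(\<Sum>a\<in>A. (line_corr p h (w ^ k) (poly (P w) a))\<^sup>2)
      \<le> real (degree f) * (\<Sum>s\<in>?R. (line_corr p h (w ^ k) s)\<^sup>2)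
         + (if w \<in> bad then real_of_int p * Q else 0)" if w: "w \<in> ?R" for w
  proof (cases "w \<in> bad")
    case True
    have "(\<Sum>a\<in>A. (line_corr p h (w ^ k) (poly (P w) a))\<^sup>2) \<le> (\<Sum>a\<in>A. Q)"
      unfolding Q_def by (intro sum_mono line_corr_sq_le assms)
    also have "\<dots> \<le> real_of_int p * Q"
    proof -
      have "card A \<le> card ?R" using A by (intro card_mono) auto
      then show ?thesis using Q0 p by (simp add: mult_right_mono)
    qed
    also have "\<dots> \<le> real (degree f) * (\<Sum>s\<in>?R. (line_corr p h (w ^ k) s)\<^sup>2) + real_of_int p * Q"
      by (simp add: sum_nonneg)
    finally show ?thesis using True by simp
  next
    case False
    then have "\<not> p dvd coeff (P w) j"
      using w j assms(1) by (auto simp: coeffP bad_def prime_dvd_mult_iff)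
    then have "(\<Sum>a\<in>?R. (line_corr p h (w ^ k) (poly (P w) a))\<^sup>2)
        \<le> real (degree (P w)) * (\<Sum>s\<in>?R. (line_corr p h (w ^ k) s)\<^sup>2)"
      using per_s by (intro sum_poly_mod_le[OF assms(1) j(1)]) auto
    also have "\<dots> \<le> real (degree f) * (\<Sum>s\<in>?R. (line_corr p h (w ^ k) s)\<^sup>2)"
      using degP by (intro mult_right_mono) (auto simp: sum_nonneg)
    finally have "(\<Sum>a\<in>?R. (line_corr p h (w ^ k) (poly (P w) a))\<^sup>2)
        \<le> real (degree f) * (\<Sum>s\<in>?R. (line_corr p h (w ^ k) s)\<^sup>2)" .
    moreover have "(\<Sum>a\<in>A. (line_corr p h (w ^ k) (poly (P w) a))\<^sup>2)
        \<le> (\<Sum>a\<in>?R. (line_corr p h (w ^ k) (poly (P w) a))\<^sup>2)"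
      using A by (intro sum_mono2) auto
    ultimately show ?thesis using False by simp
  qed
  have powers: "(\<Sum>w\<in>?R. \<Sum>s\<in>?R. (line_corr p h (w ^ k) s)\<^sup>2) \<le> real k * (real_of_int p * Q)"
  proof -
    have "\<not> p dvd coeff (monom 1 k) k" using assms(1) not_prime_unit by auto
    from sum_poly_mod_le[OF assms(1) k this per_t]
    show ?thesis
      using line_corr_second_moment[OF assms(1) per mean0]
      by (simp add: Q_def poly_monom degree_monom_eq sum_nonneg)
  qed
  have card_bad: "card bad \<le> degree f + k"
  proof -
    let ?D = "monom 1 j - monom 1 k :: int poly"
    have "\<not> p dvd coeff ?D k" using j assms(1) not_prime_unit by auto
    from card_roots_mod_prime_le[OF assms(1) this]
    have "card bad \<le> degree ?D" by (simp add: bad_def poly_monom)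
    also have "\<dots> \<le> max j k"
      by (intro degree_diff_le_max[THEN order_trans] max.mono degree_monom_le)
    also have "j \<le> degree f" using j(3) by (intro le_degree) auto
    then have "max j k \<le> degree f + k" by simp
    finally show ?thesis .
  qed
  have "(\<Sum>a\<in>A. \<Sum>b\<in>A. (T a b)\<^sup>2) \<le> (\<Sum>a\<in>A. \<Sum>w\<in>?R. (line_corr p h (w ^ k) (poly (P w) a))\<^sup>2)"
    by (intro sum_mono Tsum)
  also have "\<dots> = (\<Sum>w\<in>?R. \<Sum>a\<in>A. (line_corr p h (w ^ k) (poly (P w) a))\<^sup>2)"
    by (rule sum.swap)
  also have "\<dots> \<le> (\<Sum>w\<in>?R. real (degree f) * (\<Sum>s\<in>?R. (line_corr p h (w ^ k) s)\<^sup>2)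
         + (if w \<in> bad then real_of_int p * Q else 0))"
    by (intro sum_mono per_w)
  also have "\<dots> = real (degree f) * (\<Sum>w\<in>?R. \<Sum>s\<in>?R. (line_corr p h (w ^ k) s)\<^sup>2)
      + real (card bad) * (real_of_int p * Q)"
  proof -
    have "{w \<in> ?R. w \<in> bad} = bad" unfolding bad_def by auto
    then have "(\<Sum>w\<in>?R. if w \<in> bad then real_of_int p * Q else 0) = real (card bad) * (real_of_int p * Q)"
      by (simp flip: sum.inter_filter)
    then show ?thesis by (simp add: sum.distrib sum_distrib_left)
  qed
  also have "\<dots> \<le> real (degree f) * (real k * (real_of_int p * Q))
      + real (degree f + k) * (real_of_int p * Q)"
    using powers card_bad Q0 p by (intro add_mono mult_left_mono mult_right_mono) auto
  finally show ?thesis unfolding T_def Q_def by (simp add: algebra_simps)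
qed

section \<open>Lower bounds for the image\<close>

text \<open>
  The two applications of Cauchy-Schwarz to \<open>S\<close>. Subtracting the density \<open>\<rho>\<close> from the indicator of
  \<open>C\<close> is what makes the second moment small; the assumption on the size of \<open>C\<close> keeps \<open>h \<ge> 1 / 2\<close>
  on \<open>C\<close>. The element \<open>0\<close> is excluded from \<open>A\<close> because
  \<open>F(0, y)\<close> does not depend on \<open>y\<close>.
\<close>

lemma bivariate_expansion:
  fixes p :: int and f g :: "int poly" and A B :: "int set"
  assumes "prime p" and A: "A \<subseteq> {0..<p}" "0 \<notin> A" and B: "B \<subseteq> {0..<p}" and k: "k \<ge> 1"
    and j: "j \<ge> 1" "j \<noteq> k" "\<not> p dvd coeff f j"
    and g: "degree g \<ge> 1" "\<not> p dvd lead_coeff g"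
    and C: "C \<subseteq> {0..<p}" "\<And>a b. a \<in> A \<Longrightarrow> b \<in> B \<Longrightarrow> bivariate k f g a b mod p \<in> C"
    and small: "2 * real (card C) \<le> real_of_int p"
  shows "(real (card A) * real (card B))\<^sup>2
    \<le> 16 * (real (degree g))\<^sup>2 * real (degree f * k + (degree f + k)) * real_of_int p * (real (card C))\<^sup>2"
proof -
  let ?R = "{0..<p}"
  have p: "p > 0" using assms(1) prime_gt_0_int by blast
  define \<rho> where "\<rho> = real (card C) / real_of_int p"
  have \<rho>: "0 \<le> \<rho>" "\<rho> \<le> 1 / 2" using small p by (auto simp: \<rho>_def field_simps)
  define h where "h x = of_bool (x mod p \<in> C) - \<rho>" for x
  define a where "a = real (card A)"
  define b where "b = real (card B)"
  define c where "c = real (card C)"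
  define n where "n = real (degree g)"
  define M where "M = real (degree f * k + (degree f + k))"
  define q where "q = real_of_int p"
  define Q where "Q = (\<Sum>u\<in>?R. (h u)\<^sup>2)"
  have per: "periodic_mod p h" by (simp add: periodic_mod_def h_def)
  have sumC: "(\<Sum>u\<in>?R. of_bool (u mod p \<in> C)) = c"
  proof -
    have "?R \<inter> {u. u mod p \<in> C} = C" using C(1) by auto
    moreover have "(\<Sum>u\<in>?R. of_bool (u mod p \<in> C)) = real (card (?R \<inter> {u. u mod p \<in> C}))"
      by (rule sum_of_bool_eq) auto
    ultimately show ?thesis unfolding c_def by metis
  qed
  have q\<rho>: "q * \<rho> = c" using p by (simp add: q_def \<rho>_def c_def)
  have cardR: "real (card ?R) = q" using p by (simp add: q_def)
  have mean0: "(\<Sum>u\<in>?R. h u) = 0"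
    unfolding h_def sum_subtractf sumC using q\<rho> cardR by simp
  have "Q = (\<Sum>u\<in>?R. of_bool (u mod p \<in> C) * (1 - 2 * \<rho>) + \<rho>\<^sup>2)"
    unfolding Q_def h_def
    by (intro sum.cong refl) (auto simp: of_bool_def power2_eq_square algebra_simps)
  also have "\<dots> = c * (1 - 2 * \<rho>) + q * \<rho>\<^sup>2"
    unfolding sum.distrib using sumC cardR by (simp flip: sum_distrib_right)
  also have "\<dots> = c - c * \<rho>" using q\<rho> by (simp add: algebra_simps power2_eq_square)
  also have "\<dots> \<le> c" using \<rho> by (simp add: c_def)
  finally have Qc: "Q \<le> c" .
  have Q0: "Q \<ge> 0" unfolding Q_def by (simp add: sum_nonneg)
  define S where "S = (\<Sum>y\<in>B. \<Sum>x\<in>A. h (poly f x + x ^ k * poly g y))"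
  define W where "W = (\<Sum>y\<in>?R. (\<Sum>x\<in>A. h (poly f x + x ^ k * y))\<^sup>2)"
  have "S = (\<Sum>y\<in>B. \<Sum>x\<in>A. 1 - \<rho>)"
    unfolding S_def h_def using C(2) by (intro sum.cong refl) (auto simp: bivariate_def)
  then have "S = a * b * (1 - \<rho>)" by (simp add: a_def b_def)
  then have S_ge: "S \<ge> a * b / 2"
    using \<rho> mult_left_mono[of "1/2" "1 - \<rho>" "a * b"] by (simp add: a_def b_def)
  have S_le: "S\<^sup>2 \<le> b * n * W"
  proof -
    have per': "periodic_mod p (\<lambda>y. (\<Sum>x\<in>A. h (poly f x + x ^ k * y))\<^sup>2)"
      unfolding periodic_mod_def
      by (intro allI arg_cong[where f = "\<lambda>x. x\<^sup>2"] sum.cong refl periodic_mod_cong[OF per]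
          mod_add_cong mod_mult_cong) simp
    have "S\<^sup>2 \<le> b * (\<Sum>y\<in>B. (\<Sum>x\<in>A. h (poly f x + x ^ k * poly g y))\<^sup>2)"
      using Cauchy_Schwarz_ineq_sum[of "\<lambda>_. 1" _ B] by (simp add: S_def b_def)
    also have "(\<Sum>y\<in>B. (\<Sum>x\<in>A. h (poly f x + x ^ k * poly g y))\<^sup>2)
        \<le> (\<Sum>y\<in>?R. (\<Sum>x\<in>A. h (poly f x + x ^ k * poly g y))\<^sup>2)"
      using B by (intro sum_mono2) auto
    also have "\<dots> \<le> n * W"
      unfolding n_def W_def by (rule sum_poly_mod_le[OF assms(1) g per']) simp
    finally show ?thesis by (simp add: b_def mult.assoc mult_left_mono)
  qed
  have W_le: "W\<^sup>2 \<le> a\<^sup>2 * (M * q * Q\<^sup>2)"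
  proof -
    define T where "T x y = (\<Sum>u\<in>?R. h (poly f x + x ^ k * u) * h (poly f y + y ^ k * u))" for x y
    have "W = (\<Sum>u\<in>?R. \<Sum>x\<in>A. \<Sum>y\<in>A. h (poly f x + x ^ k * u) * h (poly f y + y ^ k * u))"
      unfolding W_def power2_eq_square sum_product ..
    also have "\<dots> = (\<Sum>x\<in>A. \<Sum>u\<in>?R. \<Sum>y\<in>A. h (poly f x + x ^ k * u) * h (poly f y + y ^ k * u))"
      by (rule sum.swap)
    also have "\<dots> = (\<Sum>x\<in>A. \<Sum>y\<in>A. T x y)"
      unfolding T_def by (intro sum.cong refl sum.swap)
    also have "\<dots> = (\<Sum>z\<in>A \<times> A. 1 * T (fst z) (snd z))"
      by (simp add: sum.cartesian_product case_prod_beta)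
    finally have "W\<^sup>2 \<le> (\<Sum>z\<in>A \<times> A. 1\<^sup>2) * (\<Sum>z\<in>A \<times> A. (T (fst z) (snd z))\<^sup>2)"
      using Cauchy_Schwarz_ineq_sum[of "\<lambda>_. 1" "\<lambda>z. T (fst z) (snd z)" "A \<times> A"] by simp
    also have "\<dots> = a\<^sup>2 * (\<Sum>x\<in>A. \<Sum>y\<in>A. (T x y)\<^sup>2)"
      by (simp add: sum.cartesian_product case_prod_beta a_def card_cartesian_product power2_eq_square)
    also have "\<dots> \<le> a\<^sup>2 * (M * q * Q\<^sup>2)"
      unfolding T_def M_def q_def Q_def
      by (intro mult_left_mono pair_correlation_second_moment_le[OF assms(1) per mean0 A k j]) simp
    finally show ?thesis .
  qed
  have nn: "a \<ge> 0" "b \<ge> 0" "c \<ge> 0" "n \<ge> 0" "M \<ge> 0" "q > 0"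
    using p by (simp_all add: a_def b_def c_def n_def M_def q_def)
  have "(a * b)^4 = 16 * (a * b / 2)^4" by (simp add: power_divide)
  also have "(a * b / 2)^4 \<le> S^4" using S_ge nn by (intro power_mono) auto
  also have "S^4 = (S\<^sup>2)\<^sup>2" by simp
  also have "\<dots> \<le> (b * n * W)\<^sup>2" using S_le by (intro power_mono) auto
  also have "\<dots> = b\<^sup>2 * n\<^sup>2 * W\<^sup>2" by (simp add: power_mult_distrib)
  also have "\<dots> \<le> b\<^sup>2 * n\<^sup>2 * (a\<^sup>2 * (M * q * Q\<^sup>2))" using W_le by (intro mult_left_mono) auto
  also have "\<dots> \<le> b\<^sup>2 * n\<^sup>2 * (a\<^sup>2 * (M * q * c\<^sup>2))"
    using Qc Q0 nn by (intro mult_left_mono power_mono) auto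
  finally have *: "(a * b)\<^sup>2 * (a * b)\<^sup>2 \<le> (a * b)\<^sup>2 * (16 * n\<^sup>2 * M * q * c\<^sup>2)"
    by (simp add: algebra_simps power_mult_distrib flip: power_add)
  have "(a * b)\<^sup>2 \<le> 16 * n\<^sup>2 * M * q * c\<^sup>2"
  proof (cases "a * b = 0")
    case True
    then have "(a * b)\<^sup>2 = 0" by simp
    also have "0 \<le> 16 * n\<^sup>2 * M * q * c\<^sup>2" using nn by simp
    finally show ?thesis .
  next
    case False
    then have "(a * b)\<^sup>2 > 0" by simp
    with * show ?thesis by (rule mult_left_le_imp_le)
  qed
  then show ?thesis by (simp only: a_def b_def c_def n_def M_def q_def)
qed

text \<open>
  If \<open>f\<close> had no such coefficient, then \<open>f = u X^k + v\<close> with the integers \<open>u = f_k\<close> and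
  \<open>v = f_0\<close>.
\<close>

lemma affinely_independent_monomD:
  assumes "affinely_independent f (monom 1 k)" and "k \<ge> 1"
  obtains j where "j \<ge> 1" "j \<noteq> k" "coeff f j \<noteq> 0"
proof -
  have "\<exists>j. j \<ge> 1 \<and> j \<noteq> k \<and> coeff f j \<noteq> 0"
  proof (rule ccontr)
    assume none: "\<not> ?thesis"
    have "f = smult (coeff f k) (monom 1 k) + [:coeff f 0:]"
    proof (rule poly_eqI)
      fix i show "coeff f i = coeff (smult (coeff f k) (monom 1 k) + [:coeff f 0:]) i"
        using none assms(2) by (cases i) (auto simp: Suc_le_eq)
    qed
    then show False using assms(1) unfolding affinely_independent_def by blast
  qed
  with that show ?thesis by blast
qed

text \<open>
  Discarding \<open>0\<close> costs at most half of \<open>A\<close>, which is why \<open>4\<close> becomes \<open>8\<close> after taking the square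
  root in \<open>bivariate_expansion\<close>.
\<close>

lemma card_image_mod_ge:
  fixes p :: nat and f g :: "int poly" and A B :: "int set"
  assumes "prime p" and A: "A \<subseteq> {0..<int p}" "card A \<ge> 2" and B: "B \<subseteq> {0..<int p}" and k: "k \<ge> 1"
    and j: "j \<ge> 1" "j \<noteq> k" "\<not> int p dvd coeff f j"
    and g: "degree g \<ge> 1" "\<not> int p dvd lead_coeff g"
  shows "real (card (image_mod p (bivariate k f g) A B))
    \<ge> min (real p / 2)
        (real (card A) * real (card B) / (8 * real (degree g) * sqrt (real (degree f * k + (degree f + k))) * sqrt (real p)))"
proof (cases "2 * real (card (image_mod p (bivariate k f g) A B)) \<le> real p")
  case False
  then show ?thesis by simp
next
  case True
  define C where "C = image_mod p (bivariate k f g) A B"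
  define n where "n = real (degree g)"
  define M where "M = real (degree f * k + (degree f + k))"
  have p: "p > 0" using assms(1) prime_gt_0_nat by blast
  have pos: "n > 0" "M > 0"
    unfolding n_def M_def of_nat_0_less_iff using g k by auto
  have "(real (card (A - {0})) * real (card B))\<^sup>2
      \<le> 16 * n\<^sup>2 * M * real_of_int (int p) * (real (card C))\<^sup>2"
    unfolding n_def M_def
  proof (rule bivariate_expansion[OF _ _ _ B k j g])
    show "C \<subseteq> {0..<int p}" using p by (auto simp: C_def image_mod_def)
    show "prime (int p)" using assms(1) by simp
    show "A - {0} \<subseteq> {0..<int p}" "0 \<notin> A - {0}" using A by auto
    show "2 * real (card C) \<le> real_of_int (int p)" using True by (simp add: C_def)
    show "bivariate k f g a b mod int p \<in> C" if "a \<in> A - {0}" "b \<in> B" for a b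
      using that by (auto simp: C_def image_mod_def)
  qed
  also have "\<dots> = (4 * n * sqrt M * sqrt (real p) * real (card C))\<^sup>2"
    using pos by (simp add: power_mult_distrib)
  finally have sq: "(real (card (A - {0})) * real (card B))\<^sup>2
      \<le> (4 * n * sqrt M * sqrt (real p) * real (card C))\<^sup>2" .
  have "0 \<le> 4 * n * sqrt M * sqrt (real p) * real (card C)"
    using pos by (intro mult_nonneg_nonneg) auto
  with sq have "real (card (A - {0})) * real (card B) \<le> 4 * n * sqrt M * sqrt (real p) * real (card C)"
    by (rule power2_le_imp_le)
  moreover have "real (card A) / 2 \<le> real (card (A - {0}))"
  proof -
    have "card A \<le> Suc (card (A - {0}))"
      using diff_card_le_card_Diff[of "{0}" A] by simp
    with A(2) show ?thesis by linarith
  qed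
  then have "real (card A) / 2 * real (card B) \<le> real (card (A - {0})) * real (card B)"
    by (rule mult_right_mono) simp
  ultimately have "real (card A) * real (card B) \<le> real (card C) * (8 * n * sqrt M * sqrt (real p))"
    by (simp add: algebra_simps)
  then have "real (card A) * real (card B) / (8 * n * sqrt M * sqrt (real p)) \<le> real (card C)"
    using pos p by (subst pos_divide_le_eq) auto
  then show ?thesis by (simp add: C_def n_def M_def)
qed

text \<open>
  The deficits are squares or products of nonnegative factors:
  \<open>1 - \<alpha> (2 - \<alpha>) = (1 - \<alpha>)^2\<close> and
  \<open>(2 \<alpha> - 1/2) - \<alpha> (\<alpha> + 1/2) = (1 - \<alpha>) (\<alpha> - 1/2)\<close>.
\<close>

lemma expansion_exponent_le:
  fixes \<alpha> :: real
  assumes "1 / 2 < \<alpha>" and "\<alpha> \<le> 1"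
  shows "\<alpha> * (1 + min (2 * \<alpha> - 1) (2 - 2 * \<alpha>) / 2) \<le> min 1 (2 * \<alpha> - 1 / 2)"
proof (rule min.boundedI)
  have "\<alpha> * (1 + min (2 * \<alpha> - 1) (2 - 2 * \<alpha>) / 2) \<le> \<alpha> * (2 - \<alpha>)"
    using assms by (intro mult_left_mono) auto
  also have "\<dots> = 1 - (1 - \<alpha>)\<^sup>2" by (simp add: power2_eq_square algebra_simps)
  finally show "\<alpha> * (1 + min (2 * \<alpha> - 1) (2 - 2 * \<alpha>) / 2) \<le> 1"
    using zero_le_power2[of "1 - \<alpha>"] by linarith
  have "\<alpha> * (1 + min (2 * \<alpha> - 1) (2 - 2 * \<alpha>) / 2) \<le> \<alpha> * (\<alpha> + 1 / 2)"
    using assms by (intro mult_left_mono) (auto simp: min_def field_simps)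
  also have "\<dots> = 2 * \<alpha> - 1 / 2 - (1 - \<alpha>) * (\<alpha> - 1 / 2)" by (simp add: field_simps)
  also have "\<dots> \<le> 2 * \<alpha> - 1 / 2" using assms by simp
  finally show "\<alpha> * (1 + min (2 * \<alpha> - 1) (2 - 2 * \<alpha>) / 2) \<le> 2 * \<alpha> - 1 / 2" .
qed

text \<open>
  Only large \<open>p\<close> need the expansion bound: there the relevant coefficients of \<open>f\<close> and \<open>g\<close> survive
  reduction modulo \<open>p\<close>, the set \<open>A\<close> has at least two elements, and \<open>\<alpha> > 1\<close> is impossible because
  \<open>|A| \<le> p\<close>. The finitely many remaining \<open>p\<close> are absorbed into the constant.
\<close>

theorem proposition5:
  fixes k :: nat and f g :: "int poly" and \<alpha> L\<^sub>1 L\<^sub>2 :: real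
  assumes "k \<ge> 1"
    and "affinely_independent f (Polynomial.monom 1 k)"
    and "Polynomial.degree g \<ge> 1"
    and "\<alpha> > 1 / 2"
    and "0 < L\<^sub>1" and "L\<^sub>1 \<le> L\<^sub>2"
  shows "\<exists>C > 0. \<forall>(p :: nat) (A :: int set) (B :: int set).
           prime p \<longrightarrow>
           A \<subseteq> carrier (residue_ring (int p)) \<longrightarrow>
           B \<subseteq> carrier (residue_ring (int p)) \<longrightarrow>
           L\<^sub>1 * real p powr \<alpha> \<le> real (card A) \<and> real (card A) \<le> L\<^sub>2 * real p powr \<alpha> \<longrightarrow>
           L\<^sub>1 * real p powr \<alpha> \<le> real (card B) \<and> real (card B) \<le> L\<^sub>2 * real p powr \<alpha> \<longrightarrow>
           real (card (image_mod p (bivariate k f g) A B))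
             \<ge> C * real (card A) powr (1 + min (2 * \<alpha> - 1) (2 - 2 * \<alpha>) / 2)"
proof -
  define E where "E = 1 + min (2 * \<alpha> - 1) (2 - 2 * \<alpha>) / 2"
  define K where "K = 8 * real (degree g) * sqrt (real (degree f * k + (degree f + k)))"
  obtain j where j: "j \<ge> 1" "j \<noteq> k" "coeff f j \<noteq> 0"
    using assms affinely_independent_monomD by blast
  have L2: "L\<^sub>2 > 0" using assms by linarith
  have "0 < real (degree g)" "0 < real (degree f * k + (degree f + k))"
    unfolding of_nat_0_less_iff using assms(1,3) by auto
  then have K: "K > 0" unfolding K_def by (intro mult_pos_pos real_sqrt_gt_zero) auto
  \<comment> \<open>The four entries of the threshold are for: coefficients nonzero modulo \<open>p\<close>, \<open>N \<ge> 1\<close>,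
    \<open>L\<^sub>1 * p powr \<alpha> \<ge> L\<^sub>1 * sqrt p \<ge> 2\<close>, and \<open>L\<^sub>1 * p powr \<alpha> > p\<close> when \<open>\<alpha> > 1\<close>.\<close>
  obtain N where N: "real N \<ge> max (max (real_of_int \<bar>coeff f j\<bar>) (real_of_int \<bar>lead_coeff g\<bar>))
      (max (max 1 ((2 / L\<^sub>1)\<^sup>2)) ((1 / L\<^sub>1) powr (1 / (\<alpha> - 1))))"
    using real_arch_simple by blast
  have N1: "real N \<ge> 1" using N by simp
  define c0 where "c0 = 1 / real N powr \<bar>E\<bar>"
  define c1 where "c1 = min (1 / 2) (L\<^sub>1\<^sup>2 / K) / L\<^sub>2 powr E"
  have c0: "c0 > 0" using N1 by (simp add: c0_def)
  have c1: "c1 > 0" using assms(5) K L2 by (simp add: c1_def)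
  have bound: "min c0 c1 * real (card A) powr E \<le> real (card (image_mod p (bivariate k f g) A B))"
    if p: "prime p" and "A \<subseteq> carrier (residue_ring (int p))" and "B \<subseteq> carrier (residue_ring (int p))"
      and cA: "L\<^sub>1 * real p powr \<alpha> \<le> real (card A)" "real (card A) \<le> L\<^sub>2 * real p powr \<alpha>"
      and cB: "L\<^sub>1 * real p powr \<alpha> \<le> real (card B)"
    for p :: nat and A B :: "int set"
  proof -
    have p1: "real p > 1" using p prime_gt_1_nat[of p] by simp
    have A: "A \<subseteq> {0..<int p}" and B: "B \<subseteq> {0..<int p}"
      using that(2,3) by (auto simp: residue_ring_def)
    have "L\<^sub>1 * real p powr \<alpha> > 0" using p1 assms(5) by simp
    then have posA: "card A > 0" and posB: "card B > 0" using cA cB by linarith+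
    have A_le: "card A \<le> p" using card_mono[OF _ A] by simp
    show ?thesis
    proof (cases "p \<le> N")
      case True
      have "real (card A) powr E \<le> real (card A) powr \<bar>E\<bar>"
        using posA by (intro powr_mono) auto
      also have "\<dots> \<le> real N powr \<bar>E\<bar>"
        using A_le True by (intro powr_mono2) auto
      finally have "c0 * real (card A) powr E \<le> 1"
        using N1 by (simp add: c0_def field_simps)
      moreover have "min c0 c1 * real (card A) powr E \<le> c0 * real (card A) powr E"
        by (intro mult_right_mono) auto
      moreover have "card (image_mod p (bivariate k f g) A B) > 0"
      proof -
        obtain x y where "x \<in> A" "y \<in> B" using posA posB by (metis card_gt_0_iff ex_in_conv)
        then have "image_mod p (bivariate k f g) A B \<noteq> {}" by (auto simp: image_mod_def)
        moreover have "image_mod p (bivariate k f g) A B \<subseteq> {0..<int p}"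
          using p1 by (auto simp: image_mod_def)
        then have "finite (image_mod p (bivariate k f g) A B)" by (rule finite_subset) auto
        ultimately show ?thesis by (simp add: card_gt_0_iff)
      qed
      ultimately show ?thesis by linarith
    next
      case False
      then have pN: "real p > real N" by simp
      have \<alpha>1: "\<alpha> \<le> 1"
      proof (rule ccontr)
        assume "\<not> \<alpha> \<le> 1"
        then have "1 / L\<^sub>1 = ((1 / L\<^sub>1) powr (1 / (\<alpha> - 1))) powr (\<alpha> - 1)"
          using assms(5) by (simp add: powr_powr)
        also have "\<dots> < real p powr (\<alpha> - 1)"
          using N pN \<open>\<not> \<alpha> \<le> 1\<close> by (intro powr_less_mono2) auto
        finally have "real p < L\<^sub>1 * real p powr \<alpha>"
          using assms(5) p1 by (simp add: powr_diff field_simps)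
        with cA(1) A_le show False by linarith
      qed
      have "2 / L\<^sub>1 \<le> sqrt (real p)" using N pN by (intro real_le_rsqrt) auto
      also have "\<dots> \<le> real p powr \<alpha>"
        using p1 assms(4) by (simp add: powr_half_sqrt[symmetric] powr_mono)
      finally have "real (card A) \<ge> 2" using cA(1) assms(5) by (simp add: field_simps)
      then have A2: "card A \<ge> 2" by simp
      have ndvd: "\<not> int p dvd c" if "c \<noteq> 0" "\<bar>c\<bar> \<le> real N" for c :: int
        using that pN dvd_imp_le_int[of c "int p"] by auto
      have ge: "real (card (image_mod p (bivariate k f g) A B))
          \<ge> min (real p / 2) (real (card A) * real (card B) / (K * sqrt (real p)))"
        unfolding K_def
      proof (rule card_image_mod_ge[OF p A A2 B assms(1) j(1,2) ndvd assms(3) ndvd])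
        show "lead_coeff g \<noteq> 0" using assms(3) by auto
      qed (use j(3) N in auto)
      have "real (card A) powr E \<le> (L\<^sub>2 * real p powr \<alpha>) powr E"
        using cA(2) \<alpha>1 assms(4) by (intro powr_mono2) (auto simp: E_def)
      also have "\<dots> = L\<^sub>2 powr E * real p powr (\<alpha> * E)"
        using L2 by (simp add: powr_mult powr_powr)
      finally have A_powr: "real (card A) powr E / L\<^sub>2 powr E \<le> real p powr (\<alpha> * E)"
        using L2 by (simp add: field_simps)
      have "min c0 c1 * real (card A) powr E \<le> c1 * real (card A) powr E"
        by (intro mult_right_mono) auto
      also have "\<dots> = min (1 / 2) (L\<^sub>1\<^sup>2 / K) * (real (card A) powr E / L\<^sub>2 powr E)"
        by (simp add: c1_def)
      also have "\<dots> \<le> min (1 / 2) (L\<^sub>1\<^sup>2 / K) * real p powr (\<alpha> * E)"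
        using A_powr K by (intro mult_left_mono) auto
      also have "\<dots> \<le> min (real p / 2) (real (card A) * real (card B) / (K * sqrt (real p)))"
      proof (rule min.boundedI)
        have "min (1 / 2) (L\<^sub>1\<^sup>2 / K) * real p powr (\<alpha> * E) \<le> 1 / 2 * real p powr 1"
          using expansion_exponent_le[OF assms(4) \<alpha>1] p1
          by (intro mult_mono powr_mono min.cobounded1) (auto simp: E_def)
        then show "min (1 / 2) (L\<^sub>1\<^sup>2 / K) * real p powr (\<alpha> * E) \<le> real p / 2" using p1 by simp
        have "min (1 / 2) (L\<^sub>1\<^sup>2 / K) * real p powr (\<alpha> * E)
            \<le> L\<^sub>1\<^sup>2 / K * real p powr (2 * \<alpha> - 1 / 2)"
          using expansion_exponent_le[OF assms(4) \<alpha>1] p1 K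
          by (intro mult_mono powr_mono min.cobounded2) (auto simp: E_def)
        also have "\<dots> = (L\<^sub>1 * real p powr \<alpha>) * (L\<^sub>1 * real p powr \<alpha>) / (K * sqrt (real p))"
        proof -
          have "real p powr (2 * \<alpha> - 1 / 2) = real p powr \<alpha> * real p powr \<alpha> / sqrt (real p)"
            unfolding powr_diff mult_2 powr_add by (subst powr_half_sqrt) (use p1 in auto)
          then show ?thesis by (simp add: power2_eq_square)
        qed
        also have "\<dots> \<le> real (card A) * real (card B) / (K * sqrt (real p))"
          using cA cB assms(5) K p1 by (intro divide_right_mono mult_mono) auto
        finally show "min (1 / 2) (L\<^sub>1\<^sup>2 / K) * real p powr (\<alpha> * E)
            \<le> real (card A) * real (card B) / (K * sqrt (real p))" .
      qed
      finally show ?thesis using ge by linarith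
    qed
  qed
  show ?thesis
    using bound c0 c1 unfolding E_def by (intro exI[of _ "min c0 c1"]) auto
qed

end
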